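(* Let $Q$ be a nonzero commutative unital ring and let $\mathbf w=(w_1,\ldots,w_n)$ be a nonempty vector of positive integers that is strongly equivalent to a vector of pairwise coprime (positive) integers. Let $R_{\mathbf w}$ be the Rees ring of $\mathbf w$ over $Q$ and $d_{\mathbf w}=\operatorname{lcm}(w_1,\ldots,w_n)$. Then the Veronese subring $R_{\mathbf w}^{(d_{\mathbf w})}$ is generated in degree $1$.
   Context: The Rees ring is the subring $R_{\mathbf w}:=Q[\{t^dx_i\mid i\in\{1,\ldots,n\},\ d\in\{0,\ldots,w_i\}\}]$ of the polynomial ring $Q[t,x_1,\ldots,x_n]$, graded by the degree in $t$ (so $x_1,\dots,x_n$ have degree $0$); equivalently it is the nonnegative-degree part of $Q[t^{-1},t^{w_1}x_1,\ldots,t^{w_n}x_n]$. Its degree-zero part is $Q[x_1,\ldots,x_n]$. For a $\mathbb Z_{\ge0}$-graded ring $S$ and an integer $r\ge1$, the $r$th Veronese subring is $S^{(r)}:=\bigoplus_{m\ge0}S_{rm}$, where $S_{rm}$ is the $m$th graded component of $S^{(r)}$. A graded ring $S$ is generated in degree $1$ if $S=S_0\oplus\bigoplus_{m\ge1}S_1^m$, where $S_1^m$ is the additive subgroup generated by $m$-fold products of elements of $S_1$. Consider the following operations on a nonempty vector of positive integers: (1) permuting the entries; (2) adding or removing repeated entries; (3) multiplying all entries by the same positive integer or dividing all entries by a positive common divisor; (4) adding or removing entries equal to the least common multiple of the entries while not changing the least common multiple. Two nonempty vectors of positive integers are strongly equivalent if they become equal after applying a suitable choice of any number of the operations (1)–(4).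 *)

theory Defs
  imports Complex_Main "HOL-Library.Multiset" "HOL-Library.Poly_Mapping"
begin

section \<open>Graded subrings of a commutative ring\<close>

definition is_additive_subgroup :: "'r::comm_ring_1 set \<Rightarrow> bool" where
  "is_additive_subgroup A \<longleftrightarrow> 0 \<in> A \<and> (\<forall>a\<in>A. \<forall>b\<in>A. a + b \<in> A) \<and> (\<forall>a\<in>A. - a \<in> A)"

definition is_subring :: "'r::comm_ring_1 set \<Rightarrow> bool" where
  "is_subring A \<longleftrightarrow> is_additive_subgroup A \<and> 1 \<in> A \<and> (\<forall>a\<in>A. \<forall>b\<in>A. a * b \<in> A)"

definition internal_sum :: "(nat \<Rightarrow> 'r::comm_ring_1 set) \<Rightarrow> 'r set" where
  "internal_sum A = {\<Sum>m\<in>F. f m | F f. finite F \<and> (\<forall>m\<in>F. f m \<in> A m)}"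

definition independent_family :: "(nat \<Rightarrow> 'r::comm_ring_1 set) \<Rightarrow> bool" where
  "independent_family A \<longleftrightarrow>
     (\<forall>F f. finite F \<and> (\<forall>m\<in>F. f m \<in> A m) \<and> (\<Sum>m\<in>F. f m) = 0 \<longrightarrow> (\<forall>m\<in>F. f m = 0))"

definition is_direct_sum :: "'r::comm_ring_1 set \<Rightarrow> (nat \<Rightarrow> 'r set) \<Rightarrow> bool" where
  "is_direct_sum R A \<longleftrightarrow>
     (\<forall>m. is_additive_subgroup (A m)) \<and> independent_family A \<and> R = internal_sum A"

text \<open>A graded ring is a subring \<open>R\<close> of the ambient commutative ring together with its
  family \<open>S\<close> of graded components.\<close>

definition is_graded_ring :: "'r::comm_ring_1 set \<Rightarrow> (nat \<Rightarrow> 'r set) \<Rightarrow> bool" where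
  "is_graded_ring R S \<longleftrightarrow>
     is_subring R \<and> is_direct_sum R S \<and> (\<forall>i j. \<forall>a\<in>S i. \<forall>b\<in>S j. a * b \<in> S (i + j))"

definition veronese_component :: "nat \<Rightarrow> (nat \<Rightarrow> 'r::comm_ring_1 set) \<Rightarrow> nat \<Rightarrow> 'r set" where
  "veronese_component r S m = S (r * m)"

definition veronese_subring :: "nat \<Rightarrow> (nat \<Rightarrow> 'r::comm_ring_1 set) \<Rightarrow> 'r set" where
  "veronese_subring r S = internal_sum (veronese_component r S)"

definition product_subgroup :: "'r::comm_ring_1 set \<Rightarrow> nat \<Rightarrow> 'r set" where
  "product_subgroup A m = is_additive_subgroup hull {\<Prod>i<m. f i | f. \<forall>i<m. f i \<in> A}"

definition generated_in_degree_1 :: "'r::comm_ring_1 set \<Rightarrow> (nat \<Rightarrow> 'r set) \<Rightarrow> bool" where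
  "generated_in_degree_1 R S \<longleftrightarrow>
     is_direct_sum R (\<lambda>m. if m = 0 then S 0 else product_subgroup (S 1) m)"


section \<open>The Rees ring\<close>

text \<open>Polynomials are finitely supported maps from exponent vectors to coefficients. The ambient
  ring has countably many variables besides \<open>T\<close>; the Rees ring of a vector of length \<open>n\<close>
  only involves \<open>X 0, \<dots>, X (n - 1)\<close>, so that \<open>X i\<close> has the weight \<open>w ! i\<close>.\<close>

datatype var = T | X nat

type_synonym 'a poly_ring = "(var \<Rightarrow>\<^sub>0 nat) \<Rightarrow>\<^sub>0 'a"

definition Const :: "'a::comm_ring_1 \<Rightarrow> 'a poly_ring" where
  "Const c = Poly_Mapping.single 0 c"

definition Var :: "var \<Rightarrow> 'a::comm_ring_1 poly_ring" where
  "Var v = Poly_Mapping.single (Poly_Mapping.single v 1) 1"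

definition rees_ring :: "nat list \<Rightarrow> 'a::comm_ring_1 poly_ring set" where
  "rees_ring w =
     is_subring hull
       ({Const c | c. True} \<union> {Var T ^ d * Var (X i) | i d. i < length w \<and> d \<le> w ! i})"

definition T_homogeneous :: "nat \<Rightarrow> 'a::comm_ring_1 poly_ring set" where
  "T_homogeneous m = {p. \<forall>u\<in>Poly_Mapping.keys p. Poly_Mapping.lookup u T = m}"

definition rees_component :: "nat list \<Rightarrow> nat \<Rightarrow> 'a::comm_ring_1 poly_ring set" where
  "rees_component w m = rees_ring w \<inter> T_homogeneous m"


section \<open>Strong equivalence of vectors\<close>

definition positive_vector :: "nat list \<Rightarrow> bool" where
  "positive_vector w \<longleftrightarrow> w \<noteq> [] \<and> (\<forall>x\<in>set w. 0 < x)"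

text \<open>Adding and removing an entry is only described at the front of the vector, since the entries
  may be permuted. In the rules \<open>add_lcm\<close> and \<open>remove_lcm\<close> the entry added or removed
  equals the least common multiple of the vector before the operation, and the last premise
  states that the operation leaves the least common multiple unchanged.\<close>

inductive operation :: "nat list \<Rightarrow> nat list \<Rightarrow> bool" where
  permute: "positive_vector u \<Longrightarrow> mset v = mset u \<Longrightarrow> operation u v"
| add_repeated: "positive_vector u \<Longrightarrow> x \<in> set u \<Longrightarrow> operation u (x # u)"
| remove_repeated: "positive_vector u \<Longrightarrow> x \<in> set u \<Longrightarrow> operation (x # u) u"
| multiply: "positive_vector u \<Longrightarrow> 0 < c \<Longrightarrow> operation u (map (\<lambda>x. c * x) u)"
| divide: "positive_vector u \<Longrightarrow> 0 < c \<Longrightarrow> \<forall>x\<in>set u. c dvd x \<Longrightarrow> operation u (map (\<lambda>x. x div c) u)"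
| add_lcm: "positive_vector u \<Longrightarrow> Lcm (set u) = x \<Longrightarrow> Lcm (set (x # u)) = Lcm (set u)
    \<Longrightarrow> operation u (x # u)"
| remove_lcm: "positive_vector u \<Longrightarrow> Lcm (set (x # u)) = x \<Longrightarrow> Lcm (set (x # u)) = Lcm (set u)
    \<Longrightarrow> operation (x # u) u"

definition strongly_equivalent :: "nat list \<Rightarrow> nat list \<Rightarrow> bool" where
  "strongly_equivalent u v \<longleftrightarrow>
     positive_vector u \<and> positive_vector v \<and> (\<exists>z. operation\<^sup>*\<^sup>* u z \<and> operation\<^sup>*\<^sup>* v z)"

definition pairwise_coprime :: "nat list \<Rightarrow> bool" where
  "pairwise_coprime v \<longleftrightarrow> pairwise (\<lambda>i j. coprime (v ! i) (v ! j)) {..<length v}"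


section \<open>Well-definedness of the gradings\<close>

lemma is_additive_subgroup_sum:
  assumes "is_additive_subgroup A" and "\<And>m. m \<in> F \<Longrightarrow> f m \<in> A"
  shows "(\<Sum>m\<in>F. f m) \<in> A"
proof (cases "finite F")
  case True
  then show ?thesis
    using assms(2)
    by (induction F) (use assms(1) in \<open>auto simp: is_additive_subgroup_def\<close>)
next
  case False
  then show ?thesis using assms(1) by (simp add: is_additive_subgroup_def)
qed

lemma is_subring_Inter:
  assumes "\<And>A. A \<in> \<A> \<Longrightarrow> is_subring A"
  shows "is_subring (\<Inter>\<A>)"
  using assms unfolding is_subring_def is_additive_subgroup_def by blast

lemma is_subring_rees_ring: "is_subring (rees_ring w)"
  unfolding rees_ring_def by (rule hull_in) (auto intro: is_subring_Inter)

lemma independent_familyD: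
  assumes "independent_family A" "finite F" "\<And>m. m \<in> F \<Longrightarrow> f m \<in> A m" "(\<Sum>m\<in>F. f m) = 0" "m \<in> F"
  shows "f m = 0"
  using assms unfolding independent_family_def by meson

lemma internal_sum_component:
  assumes "a \<in> A m"
  shows "a \<in> internal_sum A"
proof -
  have "a = (\<Sum>k\<in>{m}. a)" by simp
  then show ?thesis unfolding internal_sum_def using assms
    by (intro CollectI exI[of _ "{m}"] exI[of _ "\<lambda>_. a"]) auto
qed

lemma is_additive_subgroup_internal_sum:
  assumes A: "\<And>m. is_additive_subgroup (A m)"
  shows "is_additive_subgroup (internal_sum A)"
proof -
  have zero: "0 \<in> A m" for m using A[of m] by (simp add: is_additive_subgroup_def)
  have add: "a + b \<in> A m" if "a \<in> A m" "b \<in> A m" for a b m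
    using A[of m] that by (simp add: is_additive_subgroup_def)
  have minus: "- a \<in> A m" if "a \<in> A m" for a m
    using A[of m] that by (simp add: is_additive_subgroup_def)
  have "0 \<in> internal_sum A" using internal_sum_component[of 0 A 0] zero by simp
  moreover have "a + b \<in> internal_sum A" if ab: "a \<in> internal_sum A" "b \<in> internal_sum A" for a b
  proof -
    obtain F f where F: "finite F" "\<forall>m\<in>F. f m \<in> A m" "a = (\<Sum>m\<in>F. f m)"
      using ab(1) unfolding internal_sum_def by blast
    obtain G g where G: "finite G" "\<forall>m\<in>G. g m \<in> A m" "b = (\<Sum>m\<in>G. g m)"
      using ab(2) unfolding internal_sum_def by blast
    let ?f = "\<lambda>m. if m \<in> F then f m else 0" and ?g = "\<lambda>m. if m \<in> G then g m else 0"
    have "(\<Sum>m\<in>F \<union> G. ?f m) = a"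
      using F G by (subst sum.mono_neutral_right[of _ F]) auto
    moreover have "(\<Sum>m\<in>F \<union> G. ?g m) = b"
      using F G by (subst sum.mono_neutral_right[of _ G]) auto
    ultimately have "a + b = (\<Sum>m\<in>F \<union> G. ?f m + ?g m)" by (simp only: sum.distrib)
    moreover have "\<forall>m\<in>F \<union> G. ?f m + ?g m \<in> A m" using F G zero add by auto
    ultimately show ?thesis unfolding internal_sum_def using F G
      by (intro CollectI exI[of _ "F \<union> G"] exI[of _ "\<lambda>m. ?f m + ?g m"]) auto
  qed
  moreover have "- a \<in> internal_sum A" if a: "a \<in> internal_sum A" for a
  proof -
    obtain F f where F: "finite F" "\<forall>m\<in>F. f m \<in> A m" "a = (\<Sum>m\<in>F. f m)"
      using a unfolding internal_sum_def by blast
    then show ?thesis unfolding internal_sum_def using minus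
      by (intro CollectI exI[of _ F] exI[of _ "\<lambda>m. - f m"]) (auto simp: sum_negf)
  qed
  ultimately show ?thesis by (simp add: is_additive_subgroup_def)
qed

lemma is_subring_internal_sum:
  assumes A: "\<And>m. is_additive_subgroup (A m)"
    and mult: "\<And>i j a b. a \<in> A i \<Longrightarrow> b \<in> A j \<Longrightarrow> a * b \<in> A (i + j)"
    and one: "1 \<in> A 0"
  shows "is_subring (internal_sum A)"
proof -
  note sub = is_additive_subgroup_internal_sum[of A, OF A]
  have "a * b \<in> internal_sum A" if ab: "a \<in> internal_sum A" "b \<in> internal_sum A" for a b
  proof -
    obtain F f where F: "finite F" "\<forall>m\<in>F. f m \<in> A m" "a = (\<Sum>m\<in>F. f m)"
      using ab(1) unfolding internal_sum_def by blast
    obtain G g where G: "finite G" "\<forall>m\<in>G. g m \<in> A m" "b = (\<Sum>m\<in>G. g m)"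
      using ab(2) unfolding internal_sum_def by blast
    have "a * b = (\<Sum>i\<in>F. \<Sum>j\<in>G. f i * g j)" using F G by (simp add: sum_product)
    also have "\<dots> \<in> internal_sum A"
      using F G mult
      by (intro is_additive_subgroup_sum[OF sub]) (blast intro: internal_sum_component)
    finally show ?thesis .
  qed
  then show ?thesis
    using sub one internal_sum_component[of 1 A 0] by (simp add: is_subring_def)
qed

lemma is_additive_subgroup_T_homogeneous: "is_additive_subgroup (T_homogeneous m)"
proof -
  have "a + b \<in> T_homogeneous m" if "a \<in> T_homogeneous m" "b \<in> T_homogeneous m"
    for a b :: "'a poly_ring"
    using that Poly_Mapping.keys_add[of a b] unfolding T_homogeneous_def by blast
  moreover have "- a \<in> T_homogeneous m" if "a \<in> T_homogeneous m" for a :: "'a poly_ring"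
    using that by (auto simp: T_homogeneous_def in_keys_iff)
  moreover have "0 \<in> T_homogeneous m" by (simp add: T_homogeneous_def)
  ultimately show ?thesis by (simp add: is_additive_subgroup_def)
qed

lemma T_homogeneous_mult:
  assumes "a \<in> T_homogeneous i" "b \<in> T_homogeneous j"
  shows "a * b \<in> T_homogeneous (i + j)"
proof -
  have "Poly_Mapping.lookup u T = i + j" if u: "u \<in> Poly_Mapping.keys (a * b)" for u
  proof -
    obtain v v' where "u = v + v'" "v \<in> Poly_Mapping.keys a" "v' \<in> Poly_Mapping.keys b"
      using u Poly_Mapping.keys_mult[of a b] by blast
    then show ?thesis using assms by (simp add: T_homogeneous_def Poly_Mapping.lookup_add)
  qed
  then show ?thesis by (simp add: T_homogeneous_def)
qed

lemma Const_T_homogeneous: "Const c \<in> T_homogeneous 0"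
  by (auto simp: Const_def T_homogeneous_def split: if_splits)

lemma one_T_homogeneous: "1 \<in> T_homogeneous 0"
  using Const_T_homogeneous[of 1] by (simp add: Const_def)

lemma Var_T_homogeneous: "Var T \<in> T_homogeneous 1" "Var (X i) \<in> T_homogeneous 0"
  by (auto simp: Var_def T_homogeneous_def lookup_single)

lemma T_power_T_homogeneous: "Var T ^ d \<in> T_homogeneous d"
proof (induction d)
  case (Suc d)
  show ?case using T_homogeneous_mult[OF Var_T_homogeneous(1) Suc.IH] by simp
qed (simp add: one_T_homogeneous)

lemma generator_T_homogeneous: "Var T ^ d * Var (X i) \<in> T_homogeneous d"
  using T_homogeneous_mult[OF T_power_T_homogeneous[of d] Var_T_homogeneous(2)[of i]] by simp

lemma independent_family_T_homogeneous: "independent_family T_homogeneous"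
  unfolding independent_family_def
proof (intro allI impI ballI, elim conjE)
  fix F and f :: "nat \<Rightarrow> 'a poly_ring" and m
  assume F: "finite F" "\<forall>m\<in>F. f m \<in> T_homogeneous m" "(\<Sum>m\<in>F. f m) = 0" and m: "m \<in> F"
  show "f m = 0"
  proof (rule poly_mapping_eqI)
    fix u
    show "Poly_Mapping.lookup (f m) u = Poly_Mapping.lookup 0 u"
    proof (cases "Poly_Mapping.lookup u T = m")
      case True
      have "Poly_Mapping.lookup (f k) u = 0" if "k \<in> F - {m}" for k
      proof -
        have "\<forall>u\<in>Poly_Mapping.keys (f k). Poly_Mapping.lookup u T = k"
          using that F(2) by (simp add: T_homogeneous_def)
        moreover have "Poly_Mapping.lookup u T \<noteq> k" using that True by simp
        ultimately have "u \<notin> Poly_Mapping.keys (f k)" by blast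
        then show ?thesis by (simp add: in_keys_iff)
      qed
      then have "(\<Sum>k\<in>F. Poly_Mapping.lookup (f k) u) = (\<Sum>k\<in>{m}. Poly_Mapping.lookup (f k) u)"
        using F(1) m by (intro sum.mono_neutral_right) auto
      moreover have "(\<Sum>k\<in>F. Poly_Mapping.lookup (f k) u) = 0"
        using F(3) by (metis Poly_Mapping.lookup_sum Poly_Mapping.lookup_zero)
      ultimately show ?thesis by simp
    next
      case False
      moreover have "\<forall>u\<in>Poly_Mapping.keys (f m). Poly_Mapping.lookup u T = m"
        using F(2) m by (simp add: T_homogeneous_def)
      ultimately have "u \<notin> Poly_Mapping.keys (f m)" by blast
      then show ?thesis by (simp add: in_keys_iff)
    qed
  qed
qed

lemma is_graded_ring_rees_ring: "is_graded_ring (rees_ring w) (rees_component w)"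
proof -
  let ?A = "rees_component w :: nat \<Rightarrow> 'a poly_ring set"
  note ring = is_subring_rees_ring[of w, where 'a = 'a, unfolded is_subring_def]
  have sub: "is_additive_subgroup (?A m)" for m
    using ring is_additive_subgroup_T_homogeneous[of m, where 'a = 'a]
    by (simp add: rees_component_def is_additive_subgroup_def)
  have mult: "a * b \<in> ?A (i + j)" if "a \<in> ?A i" "b \<in> ?A j" for a b i j
    using that ring T_homogeneous_mult[of a i b j] by (simp add: rees_component_def)
  have "1 \<in> ?A 0" using ring one_T_homogeneous by (simp add: rees_component_def)
  then have "is_subring (internal_sum ?A)"
    using sub mult by (intro is_subring_internal_sum) auto
  moreover have "Const c \<in> internal_sum ?A" for c
    by (intro internal_sum_component[of _ ?A 0])
      (auto simp: rees_component_def rees_ring_def Const_T_homogeneous intro: hull_inc)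
  moreover have "Var T ^ d * Var (X i) \<in> internal_sum ?A" if "i < length w" "d \<le> w ! i" for i d
    using that by (intro internal_sum_component[of _ ?A d] )
      (auto simp: rees_component_def rees_ring_def generator_T_homogeneous intro!: hull_inc)
  ultimately have "rees_ring w \<subseteq> internal_sum ?A"
    unfolding rees_ring_def[of w] by (intro hull_minimal) auto
  moreover have "internal_sum ?A \<subseteq> rees_ring w"
  proof
    fix a assume "a \<in> internal_sum ?A"
    then obtain F f where "\<forall>m\<in>F. f m \<in> ?A m" "a = (\<Sum>m\<in>F. f m)"
      unfolding internal_sum_def by blast
    then show "a \<in> rees_ring w"
      using is_additive_subgroup_sum[of "rees_ring w" F f] ring by (auto simp: rees_component_def)
  qed
  moreover have "independent_family ?A"
    using independent_family_T_homogeneous[where 'a = 'a]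
    unfolding independent_family_def rees_component_def by blast
  ultimately show ?thesis
    using sub mult is_subring_rees_ring[of w, where 'a = 'a]
    by (simp add: is_graded_ring_def is_direct_sum_def)
qed

lemma one_in_degree_zero:
  assumes "is_graded_ring R S"
  shows "1 \<in> S 0"
proof -
  have sub: "\<And>m. is_additive_subgroup (S m)" and ind: "independent_family S"
    and R: "R = internal_sum S" and one: "1 \<in> R"
    and mult: "\<And>i j a b. a \<in> S i \<Longrightarrow> b \<in> S j \<Longrightarrow> a * b \<in> S (i + j)"
    using assms by (auto simp: is_graded_ring_def is_direct_sum_def is_subring_def)
  obtain F f where F: "finite F" "\<forall>m\<in>F. f m \<in> S m" "1 = (\<Sum>m\<in>F. f m)"
    using one R unfolding internal_sum_def by blast
  define g where "g m = (if m \<in> F then f m else 0)" for m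
  define G where "G = insert 0 F"
  have zero: "0 \<in> S m" for m using sub[of m] by (simp add: is_additive_subgroup_def)
  have g: "g m \<in> S m" for m using F zero by (auto simp: g_def)
  have G: "finite G" "0 \<in> G" using F by (auto simp: G_def)
  have sum1: "1 = (\<Sum>m\<in>G. g m)"
    unfolding G_def using F by (subst sum.mono_neutral_right[of _ F]) (auto simp: g_def)
  have e: "s * g 0 = s" if s: "s \<in> S k" for s k
  proof -
    let ?h = "\<lambda>n. s * g (n - k) - (if n = k then s else 0)"
    have "(\<Sum>n\<in>(\<lambda>m. m + k) ` G. ?h n) = (\<Sum>m\<in>G. s * g m - (if m = 0 then s else 0))"
      by (subst sum.reindex) (auto simp: inj_on_def o_def)
    also have "\<dots> = s * (\<Sum>m\<in>G. g m) - s"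
      using G by (simp add: sum_subtractf sum_distrib_left)
    also have "\<dots> = 0" using sum1 by simp
    finally have "(\<Sum>n\<in>(\<lambda>m. m + k) ` G. ?h n) = 0" .
    moreover have "?h n \<in> S n" if n: "n \<in> (\<lambda>m. m + k) ` G" for n
    proof -
      have "s * g (n - k) \<in> S n" using mult[OF s g[of "n - k"]] n by (auto simp: add.commute)
      moreover have "- (if n = k then s else 0) \<in> S n"
        using s zero sub[of n] by (auto simp: is_additive_subgroup_def)
      ultimately show ?thesis
        using sub[of n] unfolding is_additive_subgroup_def diff_conv_add_uminus by blast
    qed
    moreover have "0 + k \<in> (\<lambda>m. m + k) ` G" using G(2) by (rule imageI)
    ultimately have "?h (0 + k) = 0"
      using independent_familyD[of S "(\<lambda>m. m + k) ` G" ?h "0 + k"] ind G(1) by blast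
    then show ?thesis by simp
  qed
  have "g 0 = (\<Sum>m\<in>G. g m) * g 0" using sum1 by simp
  also have "\<dots> = (\<Sum>m\<in>G. g m)" using e[OF g] by (simp add: sum_distrib_right)
  finally show ?thesis using sum1 g[of 0] by simp
qed

lemma is_graded_ring_veronese:
  assumes S: "is_graded_ring R S" and r: "r \<ge> 1"
  shows "is_graded_ring (veronese_subring r S) (veronese_component r S)"
proof -
  let ?V = "veronese_component r S"
  have sub: "\<And>m. is_additive_subgroup (?V m)" and ind: "independent_family S"
    and mult: "\<And>i j a b. a \<in> ?V i \<Longrightarrow> b \<in> ?V j \<Longrightarrow> a * b \<in> ?V (i + j)"
    using S by (auto simp: is_graded_ring_def is_direct_sum_def veronese_component_def
        distrib_left)
  have "1 \<in> ?V 0" using one_in_degree_zero[OF S] by (simp add: veronese_component_def)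
  then have "is_subring (veronese_subring r S)"
    unfolding veronese_subring_def using sub mult by (intro is_subring_internal_sum) auto
  moreover have "independent_family ?V"
    unfolding independent_family_def
  proof (intro allI impI, elim conjE)
    fix F f assume F: "finite F" "\<forall>m\<in>F. f m \<in> ?V m" "(\<Sum>m\<in>F. f m) = 0"
    have inj: "inj_on (\<lambda>m. r * m) F" using r by (auto simp: inj_on_def)
    have "(\<Sum>n\<in>(\<lambda>m. r * m) ` F. f (n div r)) = 0"
      using F(3) r by (subst sum.reindex[OF inj]) (simp add: o_def)
    moreover have "\<forall>n\<in>(\<lambda>m. r * m) ` F. f (n div r) \<in> S n"
      using F(2) r by (auto simp: veronese_component_def)
    ultimately have "f (n div r) = 0" if "n \<in> (\<lambda>m. r * m) ` F" for n
      using independent_familyD[of S "(\<lambda>m. r * m) ` F" "\<lambda>n. f (n div r)" n]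
        ind finite_imageI[OF F(1)] that by blast
    then have "f (r * m div r) = 0" if "m \<in> F" for m using that by blast
    then show "\<forall>m\<in>F. f m = 0" using r by simp
  qed
  ultimately show ?thesis
    using sub mult by (simp add: is_graded_ring_def is_direct_sum_def veronese_subring_def)
qed

end

(* A monomial of T-degree d * m in the Rees ring is t^(d * m) x^a with the sum of the a_i w_i at
   least d * m, so it factors into m elements of degree d as soon as the multiset of weights w_i
   (each taken a_i times) splits into m parts of sum at least d. This splitting property of the set
   of entries survives all the operations. For a finite set V of pairwise coprime integers it holds
   because the least common multiple is the product: every multiset over V of sum at least twice
   the product of V contains a submultiset whose sum is exactly that product, and such parts can be
   split off one by one. *)

theory Submission
  imports Defs
begin

section \<open>Submultisets with prescribed sum\<close>

lemma sum_mset_eq_sum_count: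
  fixes M :: "nat multiset"
  assumes "finite V" "set_mset M \<subseteq> V"
  shows "\<Sum>\<^sub># M = (\<Sum>v\<in>V. count M v * v)"
  using assms(2)
proof (induction M)
  case (add x M)
  have "(\<Sum>v\<in>V. count (add_mset x M) v * v)
      = (\<Sum>v\<in>V. count M v * v + (if v = x then v else 0))"
    by (intro sum.cong) auto
  also have "\<dots> = (\<Sum>v\<in>V. count M v * v) + x"
    using add.prems assms(1) by (simp add: sum.distrib)
  finally show ?case using add by simp
qed simp

text \<open>Parts of sum \<open>L\<close> are removed one at a time. Each removal needs a remaining
  sum of at least \<open>2 * L\<close>; the surplus \<open>L\<close> in the hypothesis provides this
  up to the last removal.\<close>

lemma submultiset_sum_mult:
  fixes M :: "nat multiset"
  assumes step: "\<And>M. set_mset M \<subseteq> V \<Longrightarrow> 2 * L \<le> \<Sum>\<^sub># M \<Longrightarrow> \<exists>N. N \<subseteq># M \<and> \<Sum>\<^sub># N = L"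
    and "set_mset M \<subseteq> V" "Suc k * L \<le> \<Sum>\<^sub># M"
  shows "\<exists>N. N \<subseteq># M \<and> \<Sum>\<^sub># N = k * L"
  using assms(2,3)
proof (induction k arbitrary: M)
  case 0
  show ?case by (intro exI[of _ "{#}"]) simp
next
  case (Suc k)
  obtain N where N: "N \<subseteq># M" "\<Sum>\<^sub># N = L"
    using step[of M] Suc.prems by auto
  have "set_mset (M - N) \<subseteq> V" using Suc.prems(1) by (meson in_diffD subset_iff)
  moreover have "Suc k * L \<le> \<Sum>\<^sub># (M - N)"
    using Suc.prems(2) N by (simp add: sum_mset_diff)
  ultimately obtain K where K: "K \<subseteq># M - N" "\<Sum>\<^sub># K = k * L"
    using Suc.IH by blast
  show ?case using N K
    by (intro exI[of _ "N + K"]) (simp add: subset_mset.le_diff_conv2 add.commute)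
qed

lemma replicate_add_replicate_subseteq:
  assumes "x \<noteq> y" "a \<le> count M x" "b \<le> count M y"
  shows "replicate_mset a x + replicate_mset b y \<subseteq># M"
  using assms by (auto simp: subseteq_mset_def)

text \<open>Copies of \<open>p\<close> and \<open>q\<close> are grouped into chunks of sum \<open>p * q\<close>.\<close>

lemma submultiset_sum_two_values:
  fixes M :: "nat multiset"
  assumes "2 \<le> p" "p < q" "2 \<le> n"
    and p: "p * q * n < count M p * p + q * n"
    and q: "p * q * n < count M q * q + p * n"
  shows "\<exists>N. N \<subseteq># M \<and> \<Sum>\<^sub># N = p * q * n"
proof -
  \<comment> \<open>\<open>A\<close> counts the chunks made of \<open>q\<close> copies of
    \<open>p\<close>, and \<open>B\<close> those made of \<open>p\<close> copies of
    \<open>q\<close>; each chunk has sum \<open>p * q\<close>, and \<open>n\<close> chunks are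
    wanted.\<close>
  define A B where "A = count M p div q" and "B = count M q div p"
  have A: "n \<le> 2 * A + 1"
  proof -
    have "2 * (q * n) \<le> p * (q * n)" using \<open>2 \<le> p\<close> by (rule mult_right_mono) simp
    moreover have "p * (q * n) < p * count M p + q * n" using p by (simp add: ac_simps)
    ultimately have "p * (q * n) < p * (2 * count M p)" by linarith
    then have "q * n < 2 * count M p" by simp
    also have "\<dots> < q * (2 * A + 2)"
      using \<open>p < q\<close> dividend_less_div_times[of q "count M p"] by (simp add: A_def algebra_simps)
    finally have "n < 2 * A + 2" by (simp only: mult_less_cancel1)
    then show ?thesis by simp
  qed
  \<comment> \<open>Here \<open>q \<ge> 3\<close> because \<open>2 \<le> p < q\<close>, so the
    copies of \<open>q\<close> contribute more than two thirds of \<open>p * q * n\<close>; for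
    \<open>p\<close> only one half is available.\<close>
  have B: "2 * n \<le> 3 * B + 2"
  proof -
    have "3 * (p * n) \<le> q * (p * n)" using assms(1,2) by (intro mult_right_mono) auto
    moreover have "q * (p * n) < q * count M q + p * n" using q by (simp add: ac_simps)
    ultimately have "q * (2 * (p * n)) < q * (3 * count M q)" by linarith
    then have "p * (2 * n) < 3 * count M q" by simp
    also have "\<dots> < p * (3 * B + 3)"
      using \<open>2 \<le> p\<close> dividend_less_div_times[of p "count M q"] by (simp add: B_def algebra_simps)
    finally have "2 * n < 3 * B + 3" by (simp only: mult_less_cancel1)
    then show ?thesis by simp
  qed
  \<comment> \<open>The bounds add up to \<open>A + B \<ge> 7 * (n - 1) / 6\<close>, which exceeds
    \<open>n - 1\<close> because \<open>n \<ge> 2\<close>; integrality gives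
    \<open>n\<close>.\<close>
  have AB: "n \<le> A + B" using A B \<open>2 \<le> n\<close> by linarith
  define a where "a = min A n"
  define b where "b = n - a"
  have ab: "a \<le> A" "b \<le> B" "a + b = n" using AB by (auto simp: a_def b_def)
  have "q * a \<le> count M p" using ab(1) unfolding A_def
    by (metis order_trans mult_le_mono2 times_div_less_eq_dividend)
  moreover have "p * b \<le> count M q" using ab(2) unfolding B_def
    by (metis order_trans mult_le_mono2 times_div_less_eq_dividend)
  moreover have "\<Sum>\<^sub># (replicate_mset (q * a) p + replicate_mset (p * b) q) = p * q * n"
    by (simp add: ab(3)[symmetric] algebra_simps)
  ultimately show ?thesis using replicate_add_replicate_subseteq[of p q] \<open>p < q\<close>
    by (metis nat_neq_iff)
qed

text \<open>If some value \<open>p\<close> contributes at most \<open>\<Prod>V - \<Prod>(V - {p})\<close>, the other values carry \<open>p\<close>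
  submultisets of sum \<open>\<Prod>(V - {p})\<close> each. Otherwise all values contribute almost \<open>\<Prod>V\<close>, and
  two of them suffice.\<close>

lemma submultiset_sum_eq_prod:
  fixes M :: "nat multiset"
  assumes "finite V" "\<forall>v\<in>V. 0 < v" "set_mset M \<subseteq> V" "2 * \<Prod>V \<le> \<Sum>\<^sub># M"
  shows "\<exists>N. N \<subseteq># M \<and> \<Sum>\<^sub># N = \<Prod>V"
  using assms
proof (induction V arbitrary: M rule: finite_psubset_induct)
  case (psubset V)
  have pos: "0 < v" if "v \<in> V" for v using that psubset.prems(1) by blast
  have fac: "\<Prod>V = p * \<Prod>(V - {p})" if "p \<in> V" for p
    using psubset.hyps that by (rule prod.remove)
  \<comment> \<open>The four cases: copies of a single value suffice; a value contributes little and
    is dropped by induction; three values besides 1 all contribute much; at most two values differ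
    from 1, and copies of 1 fill the gap.\<close>
  consider (many) p where "p \<in> V" "\<Prod>V \<le> count M p * p"
    | (few) p where "p \<in> V" "count M p * p + \<Prod>(V - {p}) \<le> \<Prod>V"
    | (three) p q r where "p \<in> V - {1}" "q \<in> V - {1}" "r \<in> V - {1}" "p < q" "r \<noteq> p" "r \<noteq> q"
        "\<forall>p\<in>V. count M p * p < \<Prod>V" "\<forall>p\<in>V. \<Prod>V < count M p * p + \<Prod>(V - {p})"
    | (two) p q where "V \<subseteq> {1, p, q}" "p \<noteq> 1" "\<forall>p\<in>V. count M p * p < \<Prod>V"
  proof -
    have disj: "(\<exists>p q r. p \<in> V - {1} \<and> q \<in> V - {1} \<and> r \<in> V - {1} \<and> p < q \<and> r \<noteq> p \<and> r \<noteq> q)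
        \<or> (\<exists>p q. V \<subseteq> {1, p, q} \<and> p \<noteq> 1)"
    proof (cases "\<exists>p q. p \<in> V - {1} \<and> q \<in> V - {1} \<and> p < q")
      case True
      then obtain p q where pq: "p \<in> V - {1}" "q \<in> V - {1}" "p < q" by blast
      show ?thesis
      proof (cases "V \<subseteq> {1, p, q}")
        case True
        then show ?thesis using pq(1) by blast
      next
        case False
        then obtain r where "r \<in> V - {1}" "r \<noteq> p" "r \<noteq> q" by blast
        then show ?thesis using pq by blast
      qed
    next
      case False
      show ?thesis
      proof (cases "V \<subseteq> {1}")
        case True
        then show ?thesis by (intro disjI2 exI[of _ 2]) auto
      next
        case ne: False
        then obtain p where "p \<in> V - {1}" by blast
        moreover from this have "v = p" if "v \<in> V - {1}" for v
          using that False by (meson linorder_neqE_nat)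
        ultimately have "V \<subseteq> {1, p, p}" by blast
        with \<open>p \<in> V - {1}\<close> show ?thesis by blast
      qed
    qed
    show ?thesis
    proof (cases "\<forall>p\<in>V. count M p * p < \<Prod>V \<and> \<Prod>V < count M p * p + \<Prod>(V - {p})")
      case True
      then have "\<forall>p\<in>V. count M p * p < \<Prod>V" "\<forall>p\<in>V. \<Prod>V < count M p * p + \<Prod>(V - {p})"
        by blast+
      with disj show ?thesis using three two by (elim disjE exE conjE)
    next
      case False
      then show ?thesis using many few by (meson not_le)
    qed
  qed
  then show ?case
  proof cases
    case many
    have "\<Prod>V = \<Prod>(V - {p}) * p" using fac[OF many(1)] by simp
    moreover have "\<Prod>(V - {p}) \<le> count M p" using many(2) calculation pos[OF many(1)] by simp
    ultimately show ?thesis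
      by (intro exI[of _ "replicate_mset (\<Prod>(V - {p})) p"])
        (simp flip: count_le_replicate_mset_subset_eq)
  next
    case few
    let ?M = "filter_mset (\<lambda>v. v \<noteq> p) M"
    have M: "M = ?M + replicate_mset (count M p) p"
      by (rule multiset_eqI) auto
    have "\<Sum>\<^sub># M = \<Sum>\<^sub># ?M + count M p * p"
      by (subst M) (simp only: sum_mset.union sum_mset_replicate_mset of_nat_id)
    \<comment> \<open>Since \<open>p\<close> contributes at most
      \<open>\<Prod>V - \<Prod>(V - {p})\<close>, the other values keep at least
      \<open>\<Prod>V + \<Prod>(V - {p})\<close>, which is \<open>p + 1\<close> times
      \<open>\<Prod>(V - {p})\<close>.\<close>
    then have "Suc p * \<Prod>(V - {p}) \<le> \<Sum>\<^sub># ?M"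
      using few(2) psubset.prems(3) fac[OF few(1)] by simp
    moreover have "set_mset ?M \<subseteq> V - {p}" using psubset.prems(2) by auto
    moreover have "\<exists>N. N \<subseteq># K \<and> \<Sum>\<^sub># N = \<Prod>(V - {p})"
      if "set_mset K \<subseteq> V - {p}" "2 * \<Prod>(V - {p}) \<le> \<Sum>\<^sub># K" for K
      using few(1) psubset.prems(1) that by (intro psubset.IH) auto
    ultimately obtain N where "N \<subseteq># ?M" "\<Sum>\<^sub># N = p * \<Prod>(V - {p})"
      using submultiset_sum_mult[of "V - {p}"] by meson
    then show ?thesis using fac[OF few(1)] by (metis multiset_filter_subset subset_mset.order_trans)
  next
    case three
    define n where "n = \<Prod>(V - {p, q})"
    have p: "\<Prod>(V - {p}) = q * n"
      unfolding n_def using three psubset.hyps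
      by (subst prod.remove[of _ q]) (auto simp: Diff_insert2[symmetric])
    have q: "\<Prod>(V - {q}) = p * n"
      unfolding n_def using three psubset.hyps
      by (subst prod.remove[of _ p]) (auto simp: Diff_insert2[symmetric] insert_commute)
    have d: "\<Prod>V = p * q * n" using fac[of p] p three by simp
    \<comment> \<open>The third value \<open>r\<close> forces the cofactor \<open>n\<close> of
      \<open>p * q\<close> to be at least 2, as the chunk count requires.\<close>
    have "r dvd n" unfolding n_def using three psubset.hyps by (intro dvd_prodI) auto
    moreover have "0 < n" unfolding n_def using pos by (intro prod_pos) auto
    ultimately have "r \<le> n" by (rule dvd_imp_le)
    moreover have "2 \<le> r" "2 \<le> p" using pos[of r] pos[of p] three by auto
    ultimately show ?thesis
      unfolding d using three p q d by (intro submultiset_sum_two_values) auto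
  next
    case two
    \<comment> \<open>The bound is extended beyond \<open>V\<close> because \<open>p\<close> and
      \<open>q\<close> need not lie in \<open>V\<close>.\<close>
    have small: "count M v * v < \<Prod>V" for v
    proof (cases "v \<in> V")
      case False
      then have "count M v = 0" using psubset.prems(2) by (meson count_inI subsetD)
      moreover have "0 < \<Prod>V" using pos by (intro prod_pos) auto
      ultimately show ?thesis by simp
    qed (use two in blast)
    have "\<Sum>\<^sub># M = (\<Sum>v\<in>{1, p, q}. count M v * v)"
      using two psubset.prems(2) by (intro sum_mset_eq_sum_count) auto
    \<comment> \<open>Only an inequality, since \<open>q\<close> may coincide with 1 or
      \<open>p\<close>.\<close>
    also have "\<dots> \<le> count M 1 + count M p * p + count M q * q"
      using two(2) by (simp add: sum.insert_if)
    \<comment> \<open>Without the copies of \<open>q\<close>, more than \<open>\<Prod>V\<close> of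
      the total remains. Taking all copies of \<open>p\<close>, which stay below
      \<open>\<Prod>V\<close>, there are enough ones to reach it exactly.\<close>
    finally have "\<Prod>V - count M p * p \<le> count M 1"
      using small[of q] psubset.prems(3) by linarith
    then have "replicate_mset (count M p) p + replicate_mset (\<Prod>V - count M p * p) 1 \<subseteq># M"
      using two(2) by (intro replicate_add_replicate_subseteq) auto
    moreover have "\<Sum>\<^sub># (replicate_mset (count M p) p + replicate_mset (\<Prod>V - count M p * p) 1) = \<Prod>V"
      using small[of p] by simp
    ultimately show ?thesis by blast
  qed
qed


section \<open>Splitting multisets of entries\<close>

text \<open>Iterating the splitting yields \<open>m + 1\<close> parts of sum at least \<open>Lcm V\<close>.\<close>

definition lcm_splittable :: "nat set \<Rightarrow> bool" where
  "lcm_splittable V \<longleftrightarrow> (\<forall>M m. set_mset M \<subseteq> V \<longrightarrow> Suc m * Lcm V \<le> \<Sum>\<^sub># M \<longrightarrow>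
     (\<exists>N. N \<subseteq># M \<and> Lcm V \<le> \<Sum>\<^sub># N \<and> m * Lcm V \<le> \<Sum>\<^sub># (M - N)))"

lemma lcm_splittable_coprime:
  assumes "finite V" "V \<noteq> {}" "\<forall>v\<in>V. 0 < v" "pairwise coprime V"
  shows "lcm_splittable V"
  unfolding lcm_splittable_def
proof (intro allI impI)
  fix M :: "nat multiset" and m
  assume M: "set_mset M \<subseteq> V" "Suc m * Lcm V \<le> \<Sum>\<^sub># M"
  have Lcm: "Lcm V = \<Prod>V"
    using Lcm_coprime[of V] assms by (auto simp: pairwise_def)
  then have "\<exists>N. N \<subseteq># K \<and> \<Sum>\<^sub># N = Lcm V" if "set_mset K \<subseteq> V" "2 * Lcm V \<le> \<Sum>\<^sub># K" for K
    using assms(1,3) that by (simp add: submultiset_sum_eq_prod)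
  then obtain N where N: "N \<subseteq># M" "\<Sum>\<^sub># N = m * Lcm V"
    using submultiset_sum_mult[OF _ M] by blast
  \<comment> \<open>The submultiset of exact sum \<open>m * Lcm V\<close> is left behind; its
    complement, of sum at least \<open>Lcm V\<close>, is the part split off.\<close>
  then show "\<exists>N. N \<subseteq># M \<and> Lcm V \<le> \<Sum>\<^sub># N \<and> m * Lcm V \<le> \<Sum>\<^sub># (M - N)"
    using M(2) by (intro exI[of _ "M - N"]) (simp add: sum_mset_diff double_diff)
qed

text \<open>An element equal to \<open>Lcm V\<close> is a part by itself, and removing it lowers the
  sum by exactly \<open>Lcm V\<close>. A multiset without it lives over \<open>V\<close>, and the
  lcm is the same for both sets.\<close>

lemma lcm_splittable_insert_Lcm:
  "lcm_splittable (insert (Lcm V) V) \<longleftrightarrow> lcm_splittable V"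
proof
  assume "lcm_splittable (insert (Lcm V) V)"
  then show "lcm_splittable V" by (auto simp: lcm_splittable_def)
next
  assume V: "lcm_splittable V"
  show "lcm_splittable (insert (Lcm V) V)"
    unfolding lcm_splittable_def
  proof (intro allI impI)
    fix M m assume M: "set_mset M \<subseteq> insert (Lcm V) V" "Suc m * Lcm (insert (Lcm V) V) \<le> \<Sum>\<^sub># M"
    show "\<exists>N. N \<subseteq># M \<and> Lcm (insert (Lcm V) V) \<le> \<Sum>\<^sub># N \<and> m * Lcm (insert (Lcm V) V) \<le> \<Sum>\<^sub># (M - N)"
    proof (cases "Lcm V \<in># M")
      case True
      then show ?thesis using M(2)
        by (intro exI[of _ "{#Lcm V#}"]) (simp add: sum_mset_diff)
    next
      case False
      then show ?thesis using M V by (auto simp: lcm_splittable_def)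
    qed
  qed
qed

text \<open>Scaling by \<open>c\<close> multiplies the lcm and all sums by \<open>c\<close>, and
  multisets over the scaled set are the images of multisets over \<open>V\<close>. Nonemptiness
  matters for the lcm, as \<open>Lcm {} = 1\<close> does not scale.\<close>

lemma lcm_splittable_image_mult:
  assumes "0 < c" "V \<noteq> {}"
  shows "lcm_splittable ((*) c ` V) \<longleftrightarrow> lcm_splittable V"
proof -
  have Lcm: "Lcm ((*) c ` V) = c * Lcm V" using Lcm_mult[of V c] assms by simp
  have sum: "\<Sum>\<^sub># (image_mset ((*) c) M) = c * \<Sum>\<^sub># M" for M
    by (induction M) (simp_all add: distrib_left)
  have le: "k * (c * L) \<le> c * s \<longleftrightarrow> k * L \<le> s" for k L s
    using \<open>0 < c\<close> by (metis mult.left_commute mult_le_cancel1)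
  have le1: "c * L \<le> c * s \<longleftrightarrow> L \<le> s" for L s
    using \<open>0 < c\<close> by simp
  show ?thesis
  proof
    assume V: "lcm_splittable ((*) c ` V)"
    show "lcm_splittable V"
      unfolding lcm_splittable_def
    proof (intro allI impI)
      fix M m assume M: "set_mset M \<subseteq> V" "Suc m * Lcm V \<le> \<Sum>\<^sub># M"
      have "set_mset (image_mset ((*) c) M) \<subseteq> (*) c ` V" using M(1) by auto
      moreover have "Suc m * Lcm ((*) c ` V) \<le> \<Sum>\<^sub># (image_mset ((*) c) M)"
        using M(2) by (simp only: Lcm sum le)
      ultimately obtain N where N: "N \<subseteq># image_mset ((*) c) M" "Lcm ((*) c ` V) \<le> \<Sum>\<^sub># N"
          "m * Lcm ((*) c ` V) \<le> \<Sum>\<^sub># (image_mset ((*) c) M - N)"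
        using V unfolding lcm_splittable_def by meson
      \<comment> \<open>A decomposition of an image multiset lifts to a decomposition of
        \<open>M\<close> itself.\<close>
      from N(1) have "image_mset ((*) c) M = N + (image_mset ((*) c) M - N)" by simp
      then obtain K where "K \<subseteq># M" "N = image_mset ((*) c) K"
        by (metis image_mset_eq_plusD mset_subset_eq_add_left)
      moreover from this have "image_mset ((*) c) M - N = image_mset ((*) c) (M - K)"
        by (simp add: image_mset_Diff)
      ultimately show "\<exists>N. N \<subseteq># M \<and> Lcm V \<le> \<Sum>\<^sub># N \<and> m * Lcm V \<le> \<Sum>\<^sub># (M - N)"
        using N(2,3) by (auto simp only: Lcm sum le le1)
    qed
  next
    assume V: "lcm_splittable V"
    show "lcm_splittable ((*) c ` V)"
      unfolding lcm_splittable_def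
    proof (intro allI impI)
      fix M m assume M: "set_mset M \<subseteq> (*) c ` V" "Suc m * Lcm ((*) c ` V) \<le> \<Sum>\<^sub># M"
      obtain K where K: "M = image_mset ((*) c) K" "set_mset K \<subseteq> V"
      proof
        show "set_mset (image_mset (\<lambda>x. x div c) M) \<subseteq> V" using M(1) \<open>0 < c\<close> by auto
        have "image_mset ((*) c) (image_mset (\<lambda>x. x div c) M) = image_mset (\<lambda>x. x) M"
          unfolding image_mset.compositionality using M(1) \<open>0 < c\<close>
          by (intro image_mset_cong) auto
        then show "M = image_mset ((*) c) (image_mset (\<lambda>x. x div c) M)" by simp
      qed
      then obtain N where N: "N \<subseteq># K" "Lcm V \<le> \<Sum>\<^sub># N" "m * Lcm V \<le> \<Sum>\<^sub># (K - N)"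
        using V M(2) unfolding lcm_splittable_def by (metis Lcm sum le)
      have "image_mset ((*) c) N \<subseteq># M" using N(1) K(1) by (simp add: image_mset_subseteq_mono)
      moreover have "M - image_mset ((*) c) N = image_mset ((*) c) (K - N)"
        using N(1) K(1) by (simp add: image_mset_Diff)
      ultimately show "\<exists>N. N \<subseteq># M \<and> Lcm ((*) c ` V) \<le> \<Sum>\<^sub># N
          \<and> m * Lcm ((*) c ` V) \<le> \<Sum>\<^sub># (M - N)"
        using N(2,3) by (intro exI[of _ "image_mset ((*) c) N"]) (simp only: Lcm sum le le1 simp_thms)
    qed
  qed
qed

text \<open>The property sees only the set of entries, so permutations and repetitions leave it
  untouched; the other operations are scalings or insertions and removals of the lcm.\<close>

lemma lcm_splittable_operation:
  assumes "operation u v"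
  shows "lcm_splittable (set u) \<longleftrightarrow> lcm_splittable (set v)"
  using assms
proof cases
  case permute
  then show ?thesis using mset_eq_setD by metis
next
  case (multiply c)
  then show ?thesis
    using lcm_splittable_image_mult[of c "set u"] by (simp add: positive_vector_def image_def)
next
  case (divide c)
  \<comment> \<open>Division is treated as multiplication read backwards.\<close>
  have "set u = (*) c ` set v"
    unfolding divide(1) using divide(4) by (force simp: image_image)
  then show ?thesis
    using lcm_splittable_image_mult[of c "set v"] divide by (simp add: positive_vector_def)
next
  case (add_lcm x)
  then show ?thesis using lcm_splittable_insert_Lcm[of "set u"] by simp
next
  case (remove_lcm x)
  then show ?thesis using lcm_splittable_insert_Lcm[of "set v"] by simp
qed (simp_all add: insert_absorb)

lemma lcm_splittable_strongly_equivalent: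
  assumes "strongly_equivalent u v"
  shows "lcm_splittable (set u) \<longleftrightarrow> lcm_splittable (set v)"
proof -
  have "lcm_splittable (set u) \<longleftrightarrow> lcm_splittable (set z)" if "operation\<^sup>*\<^sup>* u z" for u z
    using that by induction (simp_all add: lcm_splittable_operation)
  then show ?thesis using assms unfolding strongly_equivalent_def by blast
qed


section \<open>Monomials of the Rees ring\<close>

text \<open>The variables form a multiset \<open>J\<close> of indices rather than an exponent
  vector, so that splitting \<open>J\<close> is the same as factoring the monomial.\<close>

definition graded_monomial :: "nat \<Rightarrow> nat multiset \<Rightarrow> var \<Rightarrow>\<^sub>0 nat" where
  "graded_monomial k J = Poly_Mapping.single T k + (\<Sum>i\<in>#J. Poly_Mapping.single (X i) 1)"

text \<open>These are the exponents of the monomials of T-degree \<open>k\<close> in the Rees ring: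
  each factor \<open>X i\<close> can carry at most \<open>w ! i\<close> powers of
  \<open>T\<close>.\<close>

definition rees_monomials :: "nat list \<Rightarrow> nat \<Rightarrow> (var \<Rightarrow>\<^sub>0 nat) set" where
  "rees_monomials w k = {graded_monomial k J | J. set_mset J \<subseteq> {..<length w} \<and> k \<le> (\<Sum>i\<in>#J. w ! i)}"

lemma graded_monomial_add: "graded_monomial (k + l) (J + K) = graded_monomial k J + graded_monomial l K"
  by (simp add: graded_monomial_def single_add ac_simps)

lemma lookup_graded_monomial_T [simp]: "Poly_Mapping.lookup (graded_monomial k J) T = k"
  by (induction J) (auto simp: graded_monomial_def lookup_add lookup_single)

lemma zero_in_rees_monomials: "0 \<in> rees_monomials w 0"
  unfolding rees_monomials_def by (intro CollectI exI[of _ "{#}"]) (simp add: graded_monomial_def)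

lemma rees_monomials_add:
  assumes "u \<in> rees_monomials w k" "v \<in> rees_monomials w l"
  shows "u + v \<in> rees_monomials w (k + l)"
proof -
  obtain J K where "u = graded_monomial k J" "set_mset J \<subseteq> {..<length w}" "k \<le> (\<Sum>i\<in>#J. w ! i)"
    and "v = graded_monomial l K" "set_mset K \<subseteq> {..<length w}" "l \<le> (\<Sum>i\<in>#K. w ! i)"
    using assms unfolding rees_monomials_def by blast
  then show ?thesis unfolding rees_monomials_def
    by (intro CollectI exI[of _ "J + K"]) (auto simp: graded_monomial_add)
qed

lemma Var_T_power_mult_Var_X:
  "Var T ^ d * Var (X i) = Poly_Mapping.single (graded_monomial d {#i#}) 1"
proof -
  have power: "Var T ^ d = Poly_Mapping.single (Poly_Mapping.single T d) 1"
    by (induction d) (simp_all add: Var_def mult_single flip: single_add)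
  show ?thesis unfolding power by (simp add: Var_def mult_single graded_monomial_def)
qed

text \<open>The polynomials supported on these exponents form a subring containing all generators,
  hence the whole Rees ring.\<close>

lemma keys_rees_ring:
  assumes "p \<in> rees_ring w"
  shows "Poly_Mapping.keys p \<subseteq> (\<Union>k. rees_monomials w k)"
  using assms unfolding rees_ring_def
proof (rule hull_induct)
  fix x
  assume "x \<in> {Const c | c. True} \<union> {Var T ^ d * Var (X i) | i d. i < length w \<and> d \<le> w ! i}"
  then consider c where "x = Const c"
    | i d where "x = Var T ^ d * Var (X i)" "i < length w" "d \<le> w ! i" by blast
  then show "Poly_Mapping.keys x \<subseteq> (\<Union>k. rees_monomials w k)"
  proof cases
    case 1
    then show ?thesis using zero_in_rees_monomials[of w] by (auto simp: Const_def)
  next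
    case 2
    have "graded_monomial d {#i#} \<in> rees_monomials w d"
      using 2 unfolding rees_monomials_def by (intro CollectI exI[of _ "{#i#}"]) simp
    then show ?thesis using 2 by (auto simp: Var_T_power_mult_Var_X)
  qed
next
  have "Poly_Mapping.keys (p + q) \<subseteq> (\<Union>k. rees_monomials w k)"
    if "Poly_Mapping.keys p \<subseteq> (\<Union>k. rees_monomials w k)" "Poly_Mapping.keys q \<subseteq> (\<Union>k. rees_monomials w k)"
    for p q :: "'a poly_ring"
    using that Poly_Mapping.keys_add[of p q] by blast
  moreover have "Poly_Mapping.keys (p * q) \<subseteq> (\<Union>k. rees_monomials w k)"
    if pq: "Poly_Mapping.keys p \<subseteq> (\<Union>k. rees_monomials w k)" "Poly_Mapping.keys q \<subseteq> (\<Union>k. rees_monomials w k)"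
    for p q :: "'a poly_ring"
  proof
    fix u assume "u \<in> Poly_Mapping.keys (p * q)"
    then obtain a b where "u = a + b" "a \<in> Poly_Mapping.keys p" "b \<in> Poly_Mapping.keys q"
      using Poly_Mapping.keys_mult[of p q] by blast
    moreover from this pq obtain k l where "a \<in> rees_monomials w k" "b \<in> rees_monomials w l" by blast
    ultimately have "u \<in> rees_monomials w (k + l)" by (simp add: rees_monomials_add)
    then show "u \<in> (\<Union>k. rees_monomials w k)" by blast
  qed
  moreover have "Poly_Mapping.keys (1 :: 'a poly_ring) \<subseteq> (\<Union>k. rees_monomials w k)"
    using zero_in_rees_monomials[of w] by auto
  ultimately show "is_subring {p :: 'a poly_ring. Poly_Mapping.keys p \<subseteq> (\<Union>k. rees_monomials w k)}"
    unfolding is_subring_def is_additive_subgroup_def by auto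
qed

lemma single_graded_monomial_in_rees_ring:
  assumes "set_mset J \<subseteq> {..<length w}" "k \<le> (\<Sum>i\<in>#J. w ! i)"
  shows "Poly_Mapping.single (graded_monomial k J) c \<in> rees_ring w"
  using assms
proof (induction J arbitrary: k)
  case empty
  have "Const c \<in> rees_ring w" unfolding rees_ring_def by (rule hull_inc) blast
  then show ?case using empty by (simp add: Const_def graded_monomial_def)
next
  case (add i J)
  \<comment> \<open>Powers of \<open>T\<close> are distributed greedily: \<open>X i\<close> takes as
    many as it can carry, and the rest stays within the capacity of \<open>J\<close>.\<close>
  define l where "l = min k (w ! i)"
  have "Poly_Mapping.single (graded_monomial (k - l) J) c \<in> rees_ring w"
    using add by (intro add.IH) (auto simp: l_def)
  moreover have "Poly_Mapping.single (graded_monomial l {#i#}) 1 \<in> rees_ring w"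
    unfolding rees_ring_def Var_T_power_mult_Var_X[symmetric]
    using add.prems by (intro hull_inc UnI2 CollectI exI[of _ i] exI[of _ l]) (simp add: l_def)
  ultimately have "Poly_Mapping.single (graded_monomial l {#i#}) 1 * Poly_Mapping.single (graded_monomial (k - l) J) c
      \<in> rees_ring w"
    using is_subring_rees_ring[of w] unfolding is_subring_def by blast
  moreover have "graded_monomial k (add_mset i J) = graded_monomial l {#i#} + graded_monomial (k - l) J"
    using graded_monomial_add[of l "k - l" "{#i#}" J] by (simp add: l_def)
  ultimately show ?case by (simp add: mult_single)
qed

lemma single_in_rees_component:
  assumes "u \<in> rees_monomials w k"
  shows "Poly_Mapping.single u c \<in> rees_component w k"
proof -
  have "Poly_Mapping.single u c \<in> rees_ring w"
    using assms single_graded_monomial_in_rees_ring unfolding rees_monomials_def by blast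
  moreover have "Poly_Mapping.lookup u T = k" using assms by (auto simp: rees_monomials_def)
  ultimately show ?thesis by (simp add: rees_component_def T_homogeneous_def)
qed

lemma keys_rees_component:
  assumes "p \<in> rees_component w k"
  shows "Poly_Mapping.keys p \<subseteq> rees_monomials w k"
proof
  fix u assume u: "u \<in> Poly_Mapping.keys p"
  then obtain l where "u \<in> rees_monomials w l"
    using assms keys_rees_ring unfolding rees_component_def by blast
  moreover from this have "Poly_Mapping.lookup u T = l" by (auto simp: rees_monomials_def)
  ultimately show "u \<in> rees_monomials w k" using assms u by (auto simp: rees_component_def T_homogeneous_def)
qed

lemma sum_single_lookup:
  "(\<Sum>u\<in>Poly_Mapping.keys p. Poly_Mapping.single u (Poly_Mapping.lookup p u)) = p"
proof (rule poly_mapping_eqI)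
  fix v
  have "(\<Sum>u\<in>Poly_Mapping.keys p. Poly_Mapping.lookup (Poly_Mapping.single u (Poly_Mapping.lookup p u)) v)
      = (\<Sum>u\<in>Poly_Mapping.keys p. if v = u then Poly_Mapping.lookup p u else 0)"
    by (intro sum.cong) (auto simp: lookup_single when_def)
  then show "Poly_Mapping.lookup
      (\<Sum>u\<in>Poly_Mapping.keys p. Poly_Mapping.single u (Poly_Mapping.lookup p u)) v
      = Poly_Mapping.lookup p v"
    by (simp add: lookup_sum in_keys_iff)
qed

text \<open>The splitting of the multiset of weights is lifted to the indices; distinct indices may
  have equal weights, so the lift need not be unique.\<close>

lemma rees_monomials_split:
  assumes "lcm_splittable (set w)" "u \<in> rees_monomials w (Lcm (set w) * Suc m)"
  shows "\<exists>a b. u = a + b \<and> a \<in> rees_monomials w (Lcm (set w)) \<and> b \<in> rees_monomials w (Lcm (set w) * m)"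
proof -
  let ?d = "Lcm (set w)"
  obtain J where J: "u = graded_monomial (?d * Suc m) J" "set_mset J \<subseteq> {..<length w}"
      "?d * Suc m \<le> (\<Sum>i\<in>#J. w ! i)"
    using assms(2) unfolding rees_monomials_def by blast
  let ?M = "image_mset ((!) w) J"
  have "set_mset ?M \<subseteq> set w" using J(2) by auto
  moreover have "Suc m * ?d \<le> \<Sum>\<^sub># ?M" using J(3) by (simp add: mult.commute)
  ultimately obtain N where N: "N \<subseteq># ?M" "?d \<le> \<Sum>\<^sub># N" "m * ?d \<le> \<Sum>\<^sub># (?M - N)"
    using assms(1) unfolding lcm_splittable_def by meson
  from N(1) have "?M = N + (?M - N)" by simp
  then obtain A B where AB: "J = A + B" "N = image_mset ((!) w) A" "?M - N = image_mset ((!) w) B"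
    by (metis image_mset_eq_plusD)
  have "graded_monomial ?d A \<in> rees_monomials w ?d" "graded_monomial (?d * m) B \<in> rees_monomials w (?d * m)"
    using J(2) N(2,3) AB by (auto simp: rees_monomials_def mult.commute)
  moreover have "u = graded_monomial ?d A + graded_monomial (?d * m) B"
    unfolding J(1) AB(1) by (simp flip: graded_monomial_add)
  ultimately show ?thesis by blast
qed

section \<open>Powers of a graded component and generation in degree 1\<close>

lemma prod_in_graded_component:
  assumes "is_graded_ring R S" "\<forall>i<m. f i \<in> S d"
  shows "(\<Prod>i<m. f i) \<in> S (d * m)"
  using assms(2)
proof (induction m)
  case 0
  show ?case using one_in_degree_zero[OF assms(1)] by simp
next
  case (Suc m)
  then show ?case using assms(1) by (auto simp: is_graded_ring_def add.commute mult.commute)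
qed

lemma product_subgroup_subset:
  assumes "is_graded_ring R S"
  shows "product_subgroup (S d) m \<subseteq> S (d * m)"
  unfolding product_subgroup_def
proof (rule hull_minimal)
  show "{\<Prod>i<m. f i | f. \<forall>i<m. f i \<in> S d} \<subseteq> S (d * m)"
    using prod_in_graded_component[OF assms] by blast
  show "is_additive_subgroup (S (d * m))"
    using assms by (simp add: is_graded_ring_def is_direct_sum_def)
qed

lemma is_additive_subgroup_product_subgroup: "is_additive_subgroup (product_subgroup A m)"
  unfolding product_subgroup_def
  by (rule hull_in) (auto simp: is_additive_subgroup_def)

text \<open>Monomials of degree \<open>Lcm (set w)\<close> are split off one by one with coefficient
  1, while the last remaining factor carries \<open>c\<close>. Counting by \<open>Suc m\<close>
  ensures that there is such a factor.\<close>

lemma single_eq_prod: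
  assumes "lcm_splittable (set w)" "u \<in> rees_monomials w (Lcm (set w) * Suc m)"
  shows "\<exists>f. (\<forall>i<Suc m. f i \<in> rees_component w (Lcm (set w)))
    \<and> Poly_Mapping.single u c = (\<Prod>i<Suc m. f i)"
  using assms(2)
proof (induction m arbitrary: u)
  case 0
  then show ?case
    by (intro exI[of _ "\<lambda>_. Poly_Mapping.single u c"]) (simp add: single_in_rees_component)
next
  case (Suc m)
  let ?d = "Lcm (set w)"
  obtain a b where ab: "u = a + b" "a \<in> rees_monomials w ?d" "b \<in> rees_monomials w (?d * Suc m)"
    using rees_monomials_split[OF assms(1) Suc.prems] by blast
  obtain f where f: "\<forall>i<Suc m. f i \<in> rees_component w ?d"
      "Poly_Mapping.single b c = (\<Prod>i<Suc m. f i)"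
    using Suc.IH[OF ab(3)] by blast
  let ?f = "f(Suc m := Poly_Mapping.single a 1)"
  have "\<forall>i<Suc (Suc m). ?f i \<in> rees_component w ?d"
    using f(1) single_in_rees_component[OF ab(2)] by (auto simp: less_Suc_eq)
  moreover have "Poly_Mapping.single u c = (\<Prod>i<Suc (Suc m). ?f i)"
  proof -
    have "Poly_Mapping.single u c = Poly_Mapping.single b c * Poly_Mapping.single a 1"
      by (simp add: ab(1) mult_single add.commute)
    also have "\<dots> = (\<Prod>i<Suc m. ?f i) * ?f (Suc m)"
      unfolding f(2) by (simp add: less_Suc_eq)
    finally show ?thesis by simp
  qed
  ultimately show ?case by blast
qed

text \<open>Every element is the sum of its terms, each of which is an \<open>m\<close>-fold
  product; the reverse inclusion is multiplicativity of the grading.\<close>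

lemma rees_component_eq_product_subgroup:
  assumes "lcm_splittable (set w)" "0 < m"
  shows "rees_component w (Lcm (set w) * m) = product_subgroup (rees_component w (Lcm (set w))) m"
    (is "?S = ?P")
proof
  let ?d = "Lcm (set w)"
  show "?P \<subseteq> ?S"
    using is_graded_ring_rees_ring by (rule product_subgroup_subset)
  show "?S \<subseteq> ?P"
  proof
    fix p
    assume p: "p \<in> ?S"
    have "Poly_Mapping.single u (Poly_Mapping.lookup p u) \<in> ?P"
      if "u \<in> Poly_Mapping.keys p" for u
    proof -
      have "u \<in> rees_monomials w (?d * Suc (m - 1))"
        using keys_rees_component[OF p] that \<open>0 < m\<close> by auto
      from single_eq_prod[OF assms(1) this] show ?thesis
        unfolding product_subgroup_def using \<open>0 < m\<close> by (intro hull_inc) auto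
    qed
    then have "(\<Sum>u\<in>Poly_Mapping.keys p. Poly_Mapping.single u (Poly_Mapping.lookup p u))
        \<in> ?P"
      by (intro is_additive_subgroup_sum is_additive_subgroup_product_subgroup)
    then show "p \<in> ?P"
      by (simp add: sum_single_lookup)
  qed
qed

theorem theorem1p22:
  fixes w v :: "nat list" and d :: nat
    and S :: "nat \<Rightarrow> 'a::comm_ring_1 poly_ring set"
  assumes "positive_vector w"
    and "positive_vector v" and "pairwise_coprime v" and "strongly_equivalent w v"
  defines "d \<equiv> Lcm (set w)"
    and "S \<equiv> rees_component w"
  shows "generated_in_degree_1 (veronese_subring d S) (veronese_component d S)"
proof -
  \<comment> \<open>Distinct values sit at distinct positions, so coprimality passes from positions
    to the set of entries.\<close>
  have "pairwise coprime (set v)"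
    using assms(3) unfolding pairwise_coprime_def pairwise_def
    by (metis in_set_conv_nth lessThan_iff)
  then have "lcm_splittable (set v)"
    using assms(2) by (intro lcm_splittable_coprime) (auto simp: positive_vector_def)
  then have "lcm_splittable (set w)"
    using lcm_splittable_strongly_equivalent[OF assms(4)] by simp
  \<comment> \<open>Once the components agree with the product subgroups, the required direct sum is
    the Veronese grading itself.\<close>
  then have "veronese_component d S
      = (\<lambda>m. if m = 0 then veronese_component d S 0
          else product_subgroup (veronese_component d S 1) m)"
    by (intro ext) (simp add: veronese_component_def d_def S_def rees_component_eq_product_subgroup)
  moreover have "1 \<le> d"
    using assms(1) Lcm_0_iff[of "set w"] unfolding d_def positive_vector_def
    by (metis One_nat_def Suc_leI finite_set gr_zeroI less_irrefl)
  then have "is_direct_sum (veronese_subring d S) (veronese_component d S)"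
    using is_graded_ring_veronese[OF is_graded_ring_rees_ring[of w, where 'a = 'a], of d]
    by (simp add: is_graded_ring_def S_def)
  ultimately show ?thesis unfolding generated_in_degree_1_def by simp
qed

end
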